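(* Let $A\in\mathcal{M}_{m\times n}(\mathbb{N})$ be a matrix with non-zero columns, let $I_A$ be the toric ideal of $A$ in $R=\mathbb{K}[e_1,\dots,e_n]$, and let $\boldsymbol{m}=e_1\cdots e_n$. Then for every integer $t\ge1$, $$\left(I_A^{t}:\boldsymbol{m}^{\infty}\right)=I_A^{(t)}.$$
   Context: $\mathbb{K}$ is an algebraically closed field of characteristic zero, and $\mathbb{N}$ includes $0$. Let $A\in\mathcal{M}_{m\times n}(\mathbb{N})$ have columns $\varsigma_1,\dots,\varsigma_n\in\mathbb{N}^m$, all non-zero. The map $\varphi_A:\mathbb{K}[e_1,\dots,e_n]\to\mathbb{K}[x_1,\dots,x_m]$ is the $\mathbb{K}$-algebra homomorphism with $\varphi_A(e_i)=x^{\varsigma_i}$, and the toric ideal of $A$ is $I_A=\ker(\varphi_A)$, a prime ideal. The $t$-th symbolic power of the prime ideal $I_A$ is $I_A^{(t)}=I_A^tR_{I_A}\cap R=\{f\in R\mid fg\in I_A^t\text{ for some }g\notin I_A\}$. For an ideal $J\subseteq R$, $J:\boldsymbol{m}^\infty=\{f\in R\mid f\boldsymbol{m}^a\in J\text{ for some integer }a\ge0\}$. *)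

theory Defs
  imports
    "HOL-Analysis.Cartesian_Space"
    "HOL-Algebra.Algebraic_Closure_Type"
    "HOL-Algebra.Ideal_Product"
    "HOL-Library.Poly_Mapping"
begin

text \<open>
  \<open>('v, 'k) mpoly\<close> is the polynomial ring with coefficients in \<open>'k\<close> and one variable for each
  element of \<open>'v\<close>: a polynomial is a finitely supported map from exponents to coefficients.
\<close>

type_synonym ('v, 'k) mpoly = "('v \<Rightarrow>\<^sub>0 nat) \<Rightarrow>\<^sub>0 'k"

abbreviation mpoly_ring :: "('v, 'k::comm_ring_1) mpoly ring" where
  "mpoly_ring \<equiv> ring_of_type_algebra"

definition mconst :: "'k::comm_ring_1 \<Rightarrow> ('v, 'k) mpoly" where
  "mconst c = Poly_Mapping.single 0 c"

definition mvar :: "'v \<Rightarrow> ('v, 'k::comm_ring_1) mpoly" where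
  "mvar v = Poly_Mapping.single (Poly_Mapping.single v 1) 1"

definition vec_monom :: "nat ^ 'v \<Rightarrow> ('v::finite, 'k::comm_ring_1) mpoly" where
  "vec_monom a = (\<Prod>v\<in>UNIV. mvar v ^ (a $ v))"

text \<open>
  The \<open>'k\<close>-algebra homomorphism sending the variable \<open>e\<^sub>j\<close> to \<open>x\<close> raised to the \<open>j\<close>-th column
  of \<open>A\<close>. It is given by substitution into each term of the polynomial; the lemmas below show
  that it has the defining properties.
\<close>

definition toric_map ::
  "nat ^ 'n ^ 'm \<Rightarrow> ('n::finite, 'k::comm_ring_1) mpoly \<Rightarrow> ('m::finite, 'k) mpoly" where
  "toric_map A f =
     (\<Sum>u\<in>Poly_Mapping.keys f.
        mconst (Poly_Mapping.lookup f u) *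
        (\<Prod>j\<in>UNIV. vec_monom (column j A) ^ Poly_Mapping.lookup u j))"

definition toric_ideal :: "nat ^ 'n ^ 'm \<Rightarrow> ('n::finite, 'k::comm_ring_1) mpoly set" where
  "toric_ideal A = a_kernel mpoly_ring (mpoly_ring :: ('m::finite, 'k) mpoly ring) (toric_map A)"

text \<open>
  Powers of ideals are powers in the monoid \<^const>\<open>ideals_set\<close> \<open>R\<close>, whose multiplication
  is the ideal product and whose unit is \<open>R\<close> itself.
\<close>

abbreviation ideal_power :: "('a, 'b) ring_scheme \<Rightarrow> 'a set \<Rightarrow> nat \<Rightarrow> 'a set" where
  "ideal_power R I t \<equiv> I [^]\<^bsub>ideals_set R\<^esub> t"

text \<open>Intended for a prime ideal \<open>P\<close>.\<close>

definition symbolic_power :: "('a, 'b) ring_scheme \<Rightarrow> 'a set \<Rightarrow> nat \<Rightarrow> 'a set" where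
  "symbolic_power R P t =
     {f \<in> carrier R. \<exists>g \<in> carrier R - P. f \<otimes>\<^bsub>R\<^esub> g \<in> ideal_power R P t}"

text \<open>The saturation \<open>J : m\<^sup>\<infinity>\<close> of an ideal \<open>J\<close> by an element \<open>m\<close>.\<close>

definition saturation :: "('a, 'b) ring_scheme \<Rightarrow> 'a set \<Rightarrow> 'a \<Rightarrow> 'a set" where
  "saturation R J m = {f \<in> carrier R. \<exists>a::nat. f \<otimes>\<^bsub>R\<^esub> (m [^]\<^bsub>R\<^esub> a) \<in> J}"

lemma mconst_0: "mconst 0 = 0"
  by (simp add: mconst_def)

lemma mconst_add: "mconst (a + b) = mconst a + mconst b"
  by (simp add: mconst_def single_add)

lemma mconst_mult: "mconst (a * b) = mconst a * mconst b"
  by (simp add: mconst_def mult_single)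

lemma toric_map_superset:
  assumes "finite S" "Poly_Mapping.keys f \<subseteq> S"
  shows "toric_map A f =
     (\<Sum>u\<in>S. mconst (Poly_Mapping.lookup f u) *
        (\<Prod>j\<in>UNIV. vec_monom (column j A) ^ Poly_Mapping.lookup u j))"
  unfolding toric_map_def using assms
  by (intro sum.mono_neutral_left) (auto simp: in_keys_iff mconst_0)

lemma toric_map_add: "toric_map A (f + g) = toric_map A f + toric_map A g"
proof -
  let ?S = "Poly_Mapping.keys f \<union> Poly_Mapping.keys g"
  have "Poly_Mapping.keys (f + g) \<subseteq> ?S" by (rule keys_add)
  then show ?thesis
    by (simp add: toric_map_superset[of ?S] lookup_add mconst_add distrib_right sum.distrib)
qed

lemma toric_map_0: "toric_map A 0 = 0"
  by (simp add: toric_map_def)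

lemma toric_map_single:
  "toric_map A (Poly_Mapping.single u c) =
     mconst c * (\<Prod>j\<in>UNIV. vec_monom (column j A) ^ Poly_Mapping.lookup u j)"
  by (subst toric_map_superset[of "{u}"]) (auto simp: in_keys_iff lookup_single when_def)

lemma mpoly_induct [case_names zero single_add]:
  fixes f :: "('v, 'k::comm_ring_1) mpoly"
  assumes "P 0" and "\<And>u c f. P f \<Longrightarrow> P (Poly_Mapping.single u c + f)"
  shows "P f"
proof (induction f rule: update_induct)
  case const
  show ?case using assms(1) .
next
  case (update f u c)
  have "Poly_Mapping.update u c f = Poly_Mapping.single u c + f"
    using update.hyps
    by (intro poly_mapping_eqI) (auto simp: lookup_update lookup_add lookup_single in_keys_iff)
  then show ?case using assms(2)[OF update.IH] by simp
qed

lemma toric_map_mult: "toric_map A (f * g) = toric_map A f * toric_map A g"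
proof (induction f rule: mpoly_induct)
  case zero
  show ?case by (simp add: toric_map_0)
next
  case f: (single_add u c f)
  have "toric_map A (Poly_Mapping.single u c * g) =
        toric_map A (Poly_Mapping.single u c) * toric_map A g"
  proof (induction g rule: mpoly_induct)
    case zero
    show ?case by (simp add: toric_map_0)
  next
    case (single_add v d g)
    have "toric_map A (Poly_Mapping.single u c * Poly_Mapping.single v d) =
          toric_map A (Poly_Mapping.single u c) * toric_map A (Poly_Mapping.single v d)"
      by (simp add: mult_single toric_map_single mconst_mult lookup_add power_add prod.distrib
          mult_ac)
    with single_add show ?case by (simp add: distrib_left toric_map_add)
  qed
  with f show ?case by (simp add: distrib_right toric_map_add)
qed

lemma toric_map_mconst: "toric_map A (mconst c) = mconst c"
  using toric_map_single[of A 0 c] by (simp add: mconst_def)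

lemma toric_map_mvar: "toric_map A (mvar j) = vec_monom (column j A)"
proof -
  have "(\<Prod>i\<in>UNIV. vec_monom (column i A) ^ Poly_Mapping.lookup (Poly_Mapping.single j 1) i) =
        (\<Prod>i\<in>UNIV. if i = j then vec_monom (column i A) else 1)"
    by (intro prod.cong) (auto simp: lookup_single when_def)
  also have "\<dots> = vec_monom (column j A)" by simp
  finally show ?thesis unfolding mvar_def toric_map_single by (simp add: mconst_def)
qed

lemma toric_map_ring_hom: "toric_map A \<in> ring_hom mpoly_ring mpoly_ring"
  using toric_map_mconst[of A 1]
  by (auto simp: ring_hom_def ring_of_type_algebra_def toric_map_add toric_map_mult mconst_def)

end

theory Submission
  imports Defs
begin

text \<open>
  Write \<open>S\<^sub>t = I\<^sup>t : m\<^sup>\<infinity>\<close>. A power of \<open>m\<close> lies outside the prime ideal \<open>I\<close>, so \<open>S\<^sub>t \<subseteq> I\<^sup>(\<^sup>t\<^sup>)\<close>. The converse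
  says that elements outside \<open>I\<close> can be cancelled modulo \<open>S\<^sub>t\<close>: if \<open>f g \<in> S\<^sub>t\<close> and \<open>g \<notin> I\<close>, then
  \<open>f \<in> S\<^sub>t\<close>. Geometrically, \<open>I\<close> defines a smooth subtorus of the torus \<open>m \<noteq> 0\<close>, and powers of the
  ideal of a smooth subvariety are primary. In characteristic zero this smoothness can be
  expressed by one vector field \<open>E = \<Sum>\<^sub>j W\<^sub>j D\<^sub>j\<close> with all \<open>W\<^sub>j \<in> I\<close> that acts on the conormal module
  \<open>I / I\<^sup>2\<close> as a scalar \<open>c\<close> that can be cancelled modulo every \<open>S\<^sub>t\<close> (an Euler vector field).

  By the Leibniz rule, \<open>E f \<equiv> t c f\<close> modulo \<open>S\<^sub>t\<^sub>+\<^sub>1\<close> for all \<open>f \<in> S\<^sub>t\<close>. Cancellation is then proved by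
  induction on \<open>t\<close> (\<open>satpow_torsion_free\<close>), where \<open>S\<^sub>1 = I\<close> is prime. Let \<open>t \<ge> 1\<close> and
  \<open>f g \<in> S\<^sub>t\<^sub>+\<^sub>1\<close>. By induction \<open>f \<in> S\<^sub>t\<close>. As \<open>g D\<^sub>j f = D\<^sub>j (f g) - f D\<^sub>j g\<close> is in \<open>S\<^sub>t\<close>, induction also gives \<open>D\<^sub>j f \<in> S\<^sub>t\<close>. Hence
  \<open>E f = \<Sum>\<^sub>j W\<^sub>j D\<^sub>j f \<in> S\<^sub>t\<^sub>+\<^sub>1\<close>, so \<open>t c f \<in> S\<^sub>t\<^sub>+\<^sub>1\<close>, and \<open>t c\<close> can be cancelled.

  To build \<open>E\<close> for a toric ideal, take \<open>D\<^sub>j = e\<^sub>j \<partial>/\<partial>e\<^sub>j\<close>. Let \<open>L\<close> be the lattice of integer vectors in the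
  kernel of \<open>A\<close>. Over the Laurent polynomials, \<open>d \<mapsto> e\<^sup>d - 1\<close> is a homomorphism from \<open>L\<close> to the additive
  group of \<open>I / I\<^sup>2\<close>, because \<open>e\<^sup>d\<^sup>+\<^sup>d\<^sup>' - 1 = (e\<^sup>d - 1) + (e\<^sup>d\<^sup>' - 1) + (e\<^sup>d - 1) (e\<^sup>d\<^sup>' - 1)\<close>. The space \<open>\<rat>\<^sup>n\<close> projects
  onto the kernel of \<open>A\<close>; clearing denominators gives \<open>N > 0\<close> and vectors \<open>p\<^sub>j \<in> L\<close> with
  \<open>\<Sum>\<^sub>j d\<^sub>j p\<^sub>j = N d\<close> for \<open>d \<in> L\<close> (\<open>integer_kernel_projection\<close>). Therefore
  \<open>\<Sum>\<^sub>j d\<^sub>j (e\<^sup>p\<^sup>j - 1) \<equiv> N (e\<^sup>d - 1)\<close> modulo \<open>I\<^sup>2\<close>, which says that the \<open>W\<^sub>j = e\<^sup>p\<^sup>j - 1\<close> have the desired property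
  on the binomials \<open>e\<^sup>u - e\<^sup>v\<close>, with \<open>c = N\<close>. These span \<open>I\<close>. A common monomial factor turns the \<open>W\<^sub>j\<close> into
  polynomials, and saturation makes that factor harmless.
\<close>

unbundle no fps_syntax

section \<open>Powers of an ideal and their saturations\<close>

lemma ring_of_type_algebra_simps [simp]:
  "carrier (ring_of_type_algebra :: 'a::comm_ring_1 ring) = UNIV"
  "x \<otimes>\<^bsub>ring_of_type_algebra\<^esub> y = x * (y :: 'a::comm_ring_1)"
  "x \<oplus>\<^bsub>ring_of_type_algebra\<^esub> y = x + (y :: 'a::comm_ring_1)"
  "\<one>\<^bsub>ring_of_type_algebra\<^esub> = (1 :: 'a::comm_ring_1)"
  "\<zero>\<^bsub>ring_of_type_algebra\<^esub> = (0 :: 'a::comm_ring_1)"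
  by (simp_all add: ring_of_type_algebra_def)

lemma nat_pow_ring_of_type_algebra [simp]:
  "x [^]\<^bsub>ring_of_type_algebra\<^esub> (n::nat) = (x :: 'a::comm_ring_1) ^ n"
proof -
  interpret R: cring "ring_of_type_algebra :: 'a ring" by (rule cring_from_type_algebra)
  show ?thesis by (induction n) (simp_all add: mult.commute)
qed

locale saturated_powers =
  fixes I :: "'a::comm_ring_1 set" and m :: 'a
  assumes ideal_I: "ideal I ring_of_type_algebra"
begin

definition pow :: "nat \<Rightarrow> 'a set" where
  "pow t = ideal_power ring_of_type_algebra I t"

definition satpow :: "nat \<Rightarrow> 'a set" where
  "satpow t = saturation ring_of_type_algebra (pow t) m"

lemma pow_0: "pow 0 = UNIV"
  by (simp add: pow_def ideals_set_def nat_pow_def)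

lemma pow_Suc: "pow (Suc t) = ideal_prod ring_of_type_algebra (pow t) I"
  by (simp add: pow_def ideals_set_def nat_pow_def)

lemma ideal_pow: "ideal (pow t) (ring_of_type_algebra :: 'a ring)"
proof -
  interpret R: cring "ring_of_type_algebra :: 'a ring" by (rule cring_from_type_algebra)
  show ?thesis
    using R.oneideal
    by (induction t) (simp_all add: pow_0 pow_Suc R.ideal_prod_is_ideal ideal_I)
qed

lemma pow_zero: "0 \<in> pow t"
  using additive_subgroup.zero_closed[OF ideal.axioms(1)[OF ideal_pow[of t]]] by simp

lemma pow_add: "x \<in> pow t \<Longrightarrow> y \<in> pow t \<Longrightarrow> x + y \<in> pow t"
  using additive_subgroup.a_closed[OF ideal.axioms(1)[OF ideal_pow[of t]]] by simp

lemma pow_mult_left: "x \<in> pow t \<Longrightarrow> r * x \<in> pow t"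
  using ideal.I_l_closed[OF ideal_pow[of t], of x r] by simp

lemma pow_SucI: "x \<in> pow t \<Longrightarrow> y \<in> I \<Longrightarrow> x * y \<in> pow (Suc t)"
  using ideal_prod.prod[of x "pow t" y I ring_of_type_algebra] by (simp add: pow_Suc)

lemma pow_Suc_induct [consumes 1, case_names mult add]:
  assumes "x \<in> pow (Suc t)"
    and "\<And>y z. y \<in> pow t \<Longrightarrow> z \<in> I \<Longrightarrow> Q (y * z)"
    and "\<And>y z. Q y \<Longrightarrow> Q z \<Longrightarrow> Q (y + z)"
  shows "Q x"
  using assms(1) unfolding pow_Suc
  by (induction rule: ideal_prod.induct) (auto intro: assms(2,3))

lemma pow_1: "pow 1 = I"
proof -
  have I_cl: "x + y \<in> I" "r * x \<in> I" if "x \<in> I" "y \<in> I" for x y r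
    using that additive_subgroup.a_closed[OF ideal.axioms(1)[OF ideal_I], of x y]
      ideal.I_l_closed[OF ideal_I, of x r] by simp_all
  have "x \<in> I" if "x \<in> pow (Suc 0)" for x
    using that by (induction rule: pow_Suc_induct) (auto intro: I_cl)
  moreover have "x \<in> pow (Suc 0)" if "x \<in> I" for x
    using pow_SucI[of 1 0 x] that by (simp add: pow_0)
  ultimately show ?thesis by auto
qed

lemma pow_antimono: "pow (Suc t) \<subseteq> pow t"
proof
  fix x assume "x \<in> pow (Suc t)"
  then show "x \<in> pow t"
    by (induction rule: pow_Suc_induct) (subst mult.commute, erule pow_mult_left, rule pow_add)
qed

lemma pow_mult: "x \<in> pow s \<Longrightarrow> y \<in> pow t \<Longrightarrow> x * y \<in> pow (s + t)"
proof (induction t arbitrary: y)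
  case 0
  then show ?case using pow_mult_left[of x s y] by (simp add: mult.commute)
next
  case (Suc t)
  from Suc.prems(2) show ?case
  proof (induction rule: pow_Suc_induct)
    case (mult y z)
    then show ?case using pow_SucI[OF Suc.IH[OF Suc.prems(1)], of y z] by (simp add: mult.assoc)
  next
    case (add y z)
    then show ?case by (simp add: distrib_left pow_add)
  qed
qed

lemma satpow_iff: "x \<in> satpow t \<longleftrightarrow> (\<exists>a. x * m ^ a \<in> pow t)"
  by (simp add: satpow_def saturation_def)

lemma pow_subset_satpow: "x \<in> pow t \<Longrightarrow> x \<in> satpow t"
  unfolding satpow_iff by (intro exI[of _ 0]) simp

lemma satpow_0: "x \<in> satpow 0"
  by (simp add: pow_0 pow_subset_satpow)

lemma I_subset_satpow: "x \<in> I \<Longrightarrow> x \<in> satpow 1"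
  using pow_subset_satpow[of x 1] by (simp only: pow_1)

lemma satpow_antimono: "x \<in> satpow (Suc t) \<Longrightarrow> x \<in> satpow t"
  using pow_antimono unfolding satpow_iff by blast

lemma satpow_add:
  assumes "x \<in> satpow t" "y \<in> satpow t"
  shows "x + y \<in> satpow t"
proof -
  obtain a b where "x * m ^ a \<in> pow t" "y * m ^ b \<in> pow t"
    using assms by (auto simp: satpow_iff)
  then have "m ^ b * (x * m ^ a) + m ^ a * (y * m ^ b) \<in> pow t"
    by (simp add: pow_add pow_mult_left)
  then have "(x + y) * m ^ (a + b) \<in> pow t"
    by (simp add: algebra_simps power_add)
  then show ?thesis by (auto simp: satpow_iff)
qed

lemma satpow_mult:
  assumes "x \<in> satpow s" "y \<in> satpow t"
  shows "x * y \<in> satpow (s + t)"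
proof -
  obtain a b where "x * m ^ a \<in> pow s" "y * m ^ b \<in> pow t"
    using assms by (auto simp: satpow_iff)
  then have "(x * m ^ a) * (y * m ^ b) \<in> pow (s + t)"
    by (rule pow_mult)
  then have "(x * y) * m ^ (a + b) \<in> pow (s + t)"
    by (simp add: algebra_simps power_add)
  then show ?thesis by (auto simp: satpow_iff)
qed

lemma satpow_mult_left: "x \<in> satpow t \<Longrightarrow> r * x \<in> satpow t"
  using satpow_mult[OF satpow_0[of r], of x t] by simp

lemma satpow_zero: "0 \<in> satpow t"
  by (simp add: pow_subset_satpow pow_zero)

lemma satpow_diff: "x \<in> satpow t \<Longrightarrow> y \<in> satpow t \<Longrightarrow> x - y \<in> satpow t"
  using satpow_add[of x t "(-1) * y"] satpow_mult_left[of y t "-1"] by simp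

lemma satpow_sum: "(\<And>j. j \<in> J \<Longrightarrow> f j \<in> satpow t) \<Longrightarrow> sum f J \<in> satpow t"
  by (induction J rule: infinite_finite_induct) (auto intro: satpow_add satpow_zero)

lemma satpow_cong: "x - y \<in> satpow t \<Longrightarrow> x \<in> satpow t \<longleftrightarrow> y \<in> satpow t"
  using satpow_add[of "x - y" t y] satpow_diff[of x t "x - y"] by auto

text \<open>
  Saturation makes \<open>m\<close> invertible in effect: relations may be multiplied by powers of \<open>m\<close> and
  divided by them again.
\<close>

lemma satpow_cancel: "x * m ^ a \<in> satpow t \<Longrightarrow> x \<in> satpow t"
  unfolding satpow_iff by (metis mult.assoc power_add)

end

section \<open>Euler operators adapted to an ideal\<close>

text \<open>
  The algebraic content of smoothness that the argument needs. The \<open>D\<^sub>j\<close> are derivations that are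
  logarithmic along \<open>m\<close>, which lets them act on saturations, and \<open>\<Sum>\<^sub>j W\<^sub>j D\<^sub>j\<close> is multiplication by
  \<open>c\<close> on \<open>I\<close> modulo the saturated square. The last assumption combines the invertibility of \<open>c\<close>
  up to saturation with characteristic zero.
\<close>

locale adapted_euler_operator = saturated_powers I m
  for I :: "'a::comm_ring_1 set" and m :: 'a +
  fixes J :: "'j set" and D :: "'j \<Rightarrow> 'a \<Rightarrow> 'a" and W :: "'j \<Rightarrow> 'a" and c :: 'a
  assumes prime: "x * y \<in> I \<Longrightarrow> x \<in> I \<or> y \<in> I"
    and m_notin: "m \<notin> I"
    and D_add: "D j (x + y) = D j x + D j y"
    and D_mult: "D j (x * y) = x * D j y + y * D j x"
    and D_m: "\<exists>d. D j m = d * m"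
    and W_in: "j \<in> J \<Longrightarrow> W j \<in> I"
    and euler: "x \<in> I \<Longrightarrow> (\<Sum>j\<in>J. W j * D j x) - c * x \<in> satpow 2"
    and cancel: "of_nat (Suc t) * (c * x) \<in> satpow s \<Longrightarrow> x \<in> satpow s"
begin

definition E :: "'a \<Rightarrow> 'a" where
  "E x = (\<Sum>j\<in>J. W j * D j x)"

lemma E_add: "E (x + y) = E x + E y"
  by (simp add: E_def D_add distrib_left sum.distrib)

lemma E_mult: "E (x * y) = x * E y + y * E x"
  by (simp add: E_def D_mult distrib_left sum.distrib sum_distrib_left mult_ac)

lemma D_m_pow: "\<exists>d. D j (m ^ a) = d * m ^ a"
proof (induction a)
  case 0
  have "D j (1 * 1) = D j 1 + D j 1" by (subst D_mult) simp
  then show ?case by (intro exI[of _ 0]) simp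
next
  case (Suc a)
  then obtain d e where "D j (m ^ a) = d * m ^ a" "D j m = e * m" using D_m by blast
  then have "D j (m ^ Suc a) = (d + e) * m ^ Suc a"
    by (simp add: D_mult algebra_simps)
  then show ?case ..
qed

lemma E_m_pow: "\<exists>d. d \<in> satpow 1 \<and> E (m ^ a) = d * m ^ a"
proof -
  define d where "d j = (SOME d. D j (m ^ a) = d * m ^ a)" for j
  have d: "D j (m ^ a) = d j * m ^ a" for j
    unfolding d_def using D_m_pow by (rule someI_ex)
  have "E (m ^ a) = (\<Sum>j\<in>J. d j * W j) * m ^ a"
    unfolding E_def sum_distrib_right by (intro sum.cong) (simp_all add: d mult_ac)
  moreover have "(\<Sum>j\<in>J. d j * W j) \<in> satpow 1"
    by (rule satpow_sum[OF satpow_mult_left[OF I_subset_satpow[OF W_in]]])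
  ultimately show ?thesis by blast
qed

lemma E_in:
  assumes "\<And>j. j \<in> J \<Longrightarrow> D j x \<in> satpow t"
  shows "E x \<in> satpow (Suc t)"
  unfolding E_def using satpow_mult[OF I_subset_satpow[OF W_in] assms]
  by (intro satpow_sum) simp

text \<open>
  A derivation removes at most one factor from a product of elements of \<open>I\<close>.
\<close>

lemma D_pow: "x \<in> pow (Suc t) \<Longrightarrow> D j x \<in> pow t"
proof (induction t arbitrary: x)
  case 0
  show ?case by (simp add: pow_0)
next
  case (Suc t)
  from Suc.prems show ?case
  proof (induction rule: pow_Suc_induct)
    case (mult y z)
    have "z * D j y \<in> pow (Suc t)"
      using pow_SucI[OF Suc.IH[OF mult(1)] mult(2)] by (simp add: mult.commute)
    moreover have "y * D j z \<in> pow (Suc t)"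
      using pow_mult_left[OF mult(1), of "D j z"] by (simp add: mult.commute)
    ultimately show ?case by (simp add: D_mult pow_add)
  next
    case (add y z)
    then show ?case by (simp add: D_add pow_add)
  qed
qed

lemma D_satpow: "x \<in> satpow (Suc t) \<Longrightarrow> D j x \<in> satpow t"
proof -
  assume "x \<in> satpow (Suc t)"
  then obtain a where a: "x * m ^ a \<in> pow (Suc t)" by (auto simp: satpow_iff)
  obtain d where d: "D j (m ^ a) = d * m ^ a" using D_m_pow by blast
  have "D j (x * m ^ a) - d * (x * m ^ a) \<in> satpow t"
    using pow_subset_satpow[OF D_pow[OF a]]
      satpow_mult_left[OF pow_subset_satpow[OF subsetD[OF pow_antimono a]]]
    by (rule satpow_diff)
  then have "D j x * m ^ a \<in> satpow t" by (simp add: D_mult d algebra_simps)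
  then show ?thesis by (rule satpow_cancel)
qed

text \<open>
  On a product of \<open>t\<close> elements of \<open>I\<close>, the Leibniz rule gives \<open>t\<close> summands, and in each of them
  \<open>E\<close> multiplies one factor by \<open>c\<close>, up to one order higher.
\<close>

lemma E_pow: "x \<in> pow t \<Longrightarrow> E x - of_nat t * (c * x) \<in> satpow (Suc t)"
proof (induction t arbitrary: x)
  case 0
  show ?case using E_in[OF satpow_0] by simp
next
  case (Suc t)
  from Suc.prems show ?case
  proof (induction rule: pow_Suc_induct)
    case (mult y z)
    have "y * (E z - c * z) \<in> satpow (t + 2)"
      using satpow_mult[OF pow_subset_satpow[OF mult(1)] euler[OF mult(2)]] by (simp add: E_def)
    moreover have "(E y - of_nat t * (c * y)) * z \<in> satpow (Suc t + 1)"
      using satpow_mult[OF Suc.IH[OF mult(1)] I_subset_satpow[OF mult(2)]] .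
    ultimately have
      "y * (E z - c * z) + (E y - of_nat t * (c * y)) * z \<in> satpow (Suc (Suc t))"
      by (intro satpow_add) simp_all
    also have "y * (E z - c * z) + (E y - of_nat t * (c * y)) * z =
        E (y * z) - of_nat (Suc t) * (c * (y * z))"
      by (simp add: E_mult algebra_simps)
    finally show ?case .
  next
    case (add y z)
    then show ?case using satpow_add[OF add] by (simp add: E_add algebra_simps)
  qed
qed

text \<open>
  Passing from \<open>f m\<^sup>a\<close> to \<open>f\<close> is possible because \<open>E (m\<^sup>a)\<close> is a multiple of \<open>m\<^sup>a\<close> with coefficient
  in the ideal; its contribution is of the higher order.
\<close>

lemma E_satpow: "x \<in> satpow t \<Longrightarrow> E x - of_nat t * (c * x) \<in> satpow (Suc t)"
proof -
  assume x: "x \<in> satpow t"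
  then obtain a where a: "x * m ^ a \<in> pow t" by (auto simp: satpow_iff)
  obtain d where d: "d \<in> satpow 1" "E (m ^ a) = d * m ^ a" using E_m_pow by blast
  have "E (x * m ^ a) - of_nat t * (c * (x * m ^ a)) - m ^ a * (d * x) \<in> satpow (Suc t)"
    using satpow_mult[OF d(1) x] satpow_diff[OF E_pow[OF a] satpow_mult_left] by simp
  then have "(E x - of_nat t * (c * x)) * m ^ a \<in> satpow (Suc t)"
    by (simp add: E_mult d algebra_simps)
  then show ?thesis by (rule satpow_cancel)
qed

lemma m_pow_notin: "m ^ a \<notin> I"
proof (induction a)
  case 0
  have "m = m * 1" by simp
  then show ?case using m_notin ideal.I_l_closed[OF ideal_I, of 1 m] by auto
next
  case (Suc a)
  then show ?case using prime m_notin by auto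
qed

lemma satpow_1: "satpow 1 = I"
proof -
  have "x \<in> I" if "x * m ^ a \<in> I" for x a
    using prime[OF that] m_pow_notin by blast
  then show ?thesis
    using I_subset_satpow unfolding set_eq_iff satpow_iff pow_1 by blast
qed

text \<open>
  The graded pieces \<open>satpow t / satpow (t + 1)\<close> are torsion free over the ring modulo \<open>I\<close>. The
  derivatives of \<open>f\<close> inherit the hypothesis on \<open>f\<close> one order lower, and the Euler operator
  recovers \<open>f\<close> from its derivatives.
\<close>

lemma satpow_torsion_free: "f * g \<in> satpow t \<Longrightarrow> g \<notin> I \<Longrightarrow> f \<in> satpow t"
proof (induction t arbitrary: f)
  case 0
  show ?case by (rule satpow_0)
next
  case (Suc t)
  have f: "f \<in> satpow t"
    using Suc.IH[OF satpow_antimono[OF Suc.prems(1)] Suc.prems(2)] .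
  show ?case
  proof (cases t)
    case 0
    then show ?thesis using Suc.prems prime[of f g] by (simp add: satpow_1[simplified])
  next
    case t: (Suc s)
    have "D j f \<in> satpow t" for j
    proof (rule Suc.IH)
      have "D j (f * g) - D j g * f \<in> satpow t"
        by (rule satpow_diff[OF D_satpow[OF Suc.prems(1)] satpow_mult_left[OF f]])
      then show "D j f * g \<in> satpow t" by (simp add: D_mult algebra_simps)
    qed (rule Suc.prems(2))
    then have "E f \<in> satpow (Suc t)" by (rule E_in)
    then have "of_nat t * (c * f) \<in> satpow (Suc t)"
      using satpow_cong[OF E_satpow[OF f]] by blast
    then show ?thesis unfolding t by (rule cancel)
  qed
qed

theorem saturation_eq_symbolic_power:
  "saturation ring_of_type_algebra (ideal_power ring_of_type_algebra I t) m = symbolic_power ring_of_type_algebra I t"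
  unfolding pow_def[symmetric] satpow_def[symmetric]
proof (intro subset_antisym subsetI)
  fix f assume "f \<in> satpow t"
  then show "f \<in> symbolic_power ring_of_type_algebra I t"
    using m_pow_notin by (auto simp: satpow_iff symbolic_power_def pow_def)
next
  fix f assume "f \<in> symbolic_power ring_of_type_algebra I t"
  then obtain g where "f * g \<in> pow t" "g \<notin> I" by (auto simp: symbolic_power_def pow_def)
  then show "f \<in> satpow t" using satpow_torsion_free pow_subset_satpow by blast
qed

end

section \<open>Polynomials as sums of monomials\<close>

definition monomial :: "('v \<Rightarrow>\<^sub>0 nat) \<Rightarrow> ('v, 'k::comm_ring_1) mpoly" where
  "monomial u = Poly_Mapping.single u 1"

lemma monomial_0: "monomial 0 = 1"
  by (simp add: monomial_def)

lemma monomial_add: "monomial (u + v) = monomial u * monomial v"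
  by (simp add: monomial_def mult_single)

lemma mconst_monomial: "mconst c * monomial u = Poly_Mapping.single u c"
  by (simp add: monomial_def mconst_def mult_single)

lemma of_nat_eq_mconst: "of_nat n = (mconst (of_nat n) :: ('v, 'k::comm_ring_1) mpoly)"
  by (induction n) (simp_all add: mconst_0 mconst_add, simp add: mconst_def)

lemma lookup_Abs_finite [simp]:
  "Poly_Mapping.lookup (Abs_poly_mapping f) v = f (v :: 'v::finite)"
  by (simp add: lookup_Abs_poly_mapping)

lemma Abs_finite_add:
  "Abs_poly_mapping (\<lambda>v. f v + g v :: nat) = Abs_poly_mapping f + Abs_poly_mapping (g :: 'v::finite \<Rightarrow> nat)"
  by (rule poly_mapping_eqI) (simp add: lookup_add)

lemma Abs_finite_0: "Abs_poly_mapping (\<lambda>v::'v::finite. 0 :: nat) = 0"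
  by (rule poly_mapping_eqI) simp

lemma Abs_finite_lookup: "Abs_poly_mapping (Poly_Mapping.lookup u) = (u :: 'v::finite \<Rightarrow>\<^sub>0 nat)"
  by (simp add: lookup_inverse)

lemma monomial_sum:
  "monomial (Abs_poly_mapping (\<lambda>v::'v::finite. \<Sum>j\<in>J. f j v)) =
     (\<Prod>j\<in>J. monomial (Abs_poly_mapping (f j)))"
  by (induction J rule: infinite_finite_induct)
    (simp_all add: Abs_finite_0 monomial_0 Abs_finite_add monomial_add)

lemma monomial_power:
  "monomial (Abs_poly_mapping f) ^ n = monomial (Abs_poly_mapping (\<lambda>v::'v::finite. n * f v))"
  by (induction n) (simp_all add: Abs_finite_0 monomial_0 Abs_finite_add monomial_add)

lemma mvar_eq_monomial: "mvar i = monomial (Abs_poly_mapping (\<lambda>v::'v::finite. if v = i then 1 else 0))"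
proof -
  have "Poly_Mapping.single i (1 :: nat) = Abs_poly_mapping (\<lambda>v. if v = i then 1 else 0)"
    by (rule poly_mapping_eqI) (simp add: lookup_single when_def)
  then show ?thesis unfolding mvar_def monomial_def by (rule arg_cong)
qed

lemma vec_monom_eq_monomial: "vec_monom a = monomial (Abs_poly_mapping (\<lambda>v. a $ v))"
  unfolding vec_monom_def mvar_eq_monomial monomial_power monomial_sum[symmetric]
  by (simp add: if_distrib[of "(*) _"] cong: if_cong)

lemma prod_mvar_power:
  "(\<Prod>j\<in>UNIV. mvar j) ^ a = monomial (Abs_poly_mapping (\<lambda>v::'v::finite. a))"
  unfolding mvar_eq_monomial monomial_sum[symmetric] monomial_power by simp

definition toric_exponent :: "nat ^ 'n ^ 'm \<Rightarrow> ('n::finite \<Rightarrow>\<^sub>0 nat) \<Rightarrow> ('m::finite \<Rightarrow>\<^sub>0 nat)" where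
  "toric_exponent A u = Abs_poly_mapping (\<lambda>i. \<Sum>j\<in>UNIV. A $ i $ j * Poly_Mapping.lookup u j)"

lemma toric_map_single':
  "toric_map A (Poly_Mapping.single u c) = Poly_Mapping.single (toric_exponent A u) c"
  unfolding toric_map_single vec_monom_eq_monomial monomial_power monomial_sum[symmetric]
    mconst_monomial toric_exponent_def column_def
  by (simp add: mult.commute)

text \<open>
  The ring homomorphism induced by an additive map of exponents; a toric map is of this kind, and
  so is an injective renaming of variables.
\<close>

definition map_exponents ::
  "(('v \<Rightarrow>\<^sub>0 nat) \<Rightarrow> ('w \<Rightarrow>\<^sub>0 nat)) \<Rightarrow> ('v, 'k::comm_ring_1) mpoly \<Rightarrow> ('w, 'k) mpoly" where
  "map_exponents h f = (\<Sum>u\<in>Poly_Mapping.keys f. Poly_Mapping.single (h u) (Poly_Mapping.lookup f u))"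

lemma map_exponents_superset:
  assumes "finite S" "Poly_Mapping.keys f \<subseteq> S"
  shows "map_exponents h f = (\<Sum>u\<in>S. Poly_Mapping.single (h u) (Poly_Mapping.lookup f u))"
  unfolding map_exponents_def using assms
  by (intro sum.mono_neutral_left) (auto simp: in_keys_iff)

lemma map_exponents_0: "map_exponents h 0 = 0"
  by (simp add: map_exponents_def)

lemma map_exponents_single:
  "map_exponents h (Poly_Mapping.single u c) = Poly_Mapping.single (h u) c"
  by (subst map_exponents_superset[of "{u}"]) (auto simp: in_keys_iff lookup_single when_def)

lemma map_exponents_add: "map_exponents h (f + g) = map_exponents h f + map_exponents h g"
  by (simp add: map_exponents_superset[of "Poly_Mapping.keys f \<union> Poly_Mapping.keys g"]
      keys_add lookup_add single_add sum.distrib)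

lemma map_exponents_mult:
  assumes "\<And>u v. h (u + v) = h u + h v"
  shows "map_exponents h (f * g) = map_exponents h f * map_exponents h g"
proof (induction f rule: mpoly_induct)
  case (single_add u c f)
  have "map_exponents h (Poly_Mapping.single u c * g) =
      map_exponents h (Poly_Mapping.single u c) * map_exponents h g"
    by (induction g rule: mpoly_induct)
      (simp_all add: map_exponents_0 map_exponents_add map_exponents_single mult_single assms
        distrib_left)
  with single_add show ?case by (simp add: distrib_right map_exponents_add)
qed (simp add: map_exponents_0)

lemma lookup_map_exponents:
  "Poly_Mapping.lookup (map_exponents h f) b =
     (\<Sum>u\<in>Poly_Mapping.keys f. Poly_Mapping.lookup f u when h u = b)"
  by (simp add: map_exponents_def lookup_sum lookup_single)

lemma inj_map_exponents:
  assumes "inj h" "map_exponents h f = 0"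
  shows "f = 0"
proof (rule poly_mapping_eqI)
  fix b
  have "0 = Poly_Mapping.lookup (map_exponents h f) (h b)" using assms by simp
  also have "\<dots> = (\<Sum>u\<in>Poly_Mapping.keys f. if u = b then Poly_Mapping.lookup f u else 0)"
    unfolding lookup_map_exponents using assms(1)
    by (intro sum.cong) (auto simp: when_def inj_eq)
  also have "\<dots> = Poly_Mapping.lookup f b"
    by (simp add: in_keys_iff)
  finally show "Poly_Mapping.lookup f b = Poly_Mapping.lookup 0 b" by simp
qed

lemma toric_map_eq_map_exponents: "toric_map A = map_exponents (toric_exponent A)"
proof
  fix f show "toric_map A f = map_exponents (toric_exponent A) f"
    by (induction f rule: mpoly_induct)
      (simp_all add: toric_map_0 map_exponents_0 toric_map_add map_exponents_add
        toric_map_single' map_exponents_single)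
qed

text \<open>
  With linearly ordered variables, the leading term of a product is the product of the leading terms.
  Naming the variables by natural numbers reduces the general case to that one.
\<close>

lemma mpoly_no_zero_divisors:
  fixes f g :: "('v::finite, 'k::idom) mpoly"
  assumes "f * g = 0"
  shows "f = 0 \<or> g = 0"
proof -
  obtain enc :: "'v \<Rightarrow> nat" where enc: "inj enc"
    using finite_imp_inj_to_nat_seg[OF finite[of UNIV]] by blast
  define h :: "('v \<Rightarrow>\<^sub>0 nat) \<Rightarrow> (nat \<Rightarrow>\<^sub>0 nat)" where
    "h u = Abs_poly_mapping (\<lambda>n. if n \<in> range enc then Poly_Mapping.lookup u (inv_into UNIV enc n) else 0)" for u
  have lookup_h: "Poly_Mapping.lookup (h u) =
      (\<lambda>n. if n \<in> range enc then Poly_Mapping.lookup u (inv_into UNIV enc n) else 0)" for u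
    unfolding h_def
    by (subst lookup_Abs_poly_mapping)
      (auto intro: finite_subset[OF _ finite_imageI[OF finite[of UNIV], of enc]])
  have add: "h (u + v) = h u + h v" for u v
    by (rule poly_mapping_eqI) (simp add: lookup_h lookup_add)
  have inj: "inj h"
  proof (rule injI)
    fix u v assume "h u = h v"
    then have "Poly_Mapping.lookup (h u) (enc i) = Poly_Mapping.lookup (h v) (enc i)" for i by simp
    then show "u = v" by (intro poly_mapping_eqI) (simp add: lookup_h enc)
  qed
  have "map_exponents h f * map_exponents h g = 0"
    using assms by (simp add: map_exponents_mult[OF add, symmetric] map_exponents_0)
  then show ?thesis using inj_map_exponents[OF inj] by auto
qed

section \<open>Toric ideals\<close>

lemma toric_ideal_iff: "f \<in> toric_ideal A \<longleftrightarrow> toric_map A f = 0"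
  by (simp add: toric_ideal_def a_kernel_def')

lemma ideal_toric_ideal:
  "ideal (toric_ideal A :: ('n::finite, 'k::comm_ring_1) mpoly set) ring_of_type_algebra"
  unfolding toric_ideal_def
  by (intro ring_hom_ring.kernel_is_ideal ring_hom_ringI2 ring_from_type_algebra toric_map_ring_hom)

lemma toric_ideal_prime:
  fixes f g :: "('n::finite, 'k::idom) mpoly"
  shows "f * g \<in> toric_ideal A \<Longrightarrow> f \<in> toric_ideal A \<or> g \<in> toric_ideal A"
  using mpoly_no_zero_divisors[of "toric_map A f" "toric_map A g"]
  by (simp add: toric_ideal_iff toric_map_mult)

lemma monomial_notin_toric_ideal: "monomial u \<notin> toric_ideal A"
proof -
  have "Poly_Mapping.lookup (toric_map A (monomial u)) (toric_exponent A u) = 1"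
    by (simp add: monomial_def toric_map_single')
  then show ?thesis unfolding toric_ideal_iff by (metis lookup_zero zero_neq_one)
qed

lemma binomial_in_toric_ideal:
  "toric_exponent A u = toric_exponent A v \<Longrightarrow> monomial u - monomial v \<in> toric_ideal A"
  using toric_map_add[of A "monomial u - monomial v" "monomial v"]
  by (simp add: toric_ideal_iff monomial_def toric_map_single')

text \<open>
  A toric ideal is spanned by the binomials that it contains: if \<open>f\<close> is in the kernel, the image of
  a term of \<open>f\<close> must cancel against that of another term with the same image exponent, so that
  a multiple of a binomial can be subtracted to make \<open>f\<close> shorter.
\<close>

lemma toric_ideal_induct [consumes 1, case_names zero binomial]:
  fixes f :: "('n::finite, 'k::comm_ring_1) mpoly"
  assumes "f \<in> toric_ideal A"
    and "P 0"
    and "\<And>u v c f. toric_exponent A u = toric_exponent A v \<Longrightarrow> P f \<Longrightarrow>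
           P (mconst c * (monomial u - monomial v) + f)"
  shows "P f"
  using assms(1)
proof (induction "card (Poly_Mapping.keys f)" arbitrary: f rule: less_induct)
  case less
  show ?case
  proof (cases "f = 0")
    case True
    then show ?thesis using assms(2) by simp
  next
    case False
    then obtain u where u: "u \<in> Poly_Mapping.keys f" by (metis ex_in_conv keys_eq_empty)
    define c where "c = Poly_Mapping.lookup f u"
    have "c \<noteq> 0" using u by (simp add: c_def in_keys_iff)
    have "\<exists>v\<in>Poly_Mapping.keys f - {u}. toric_exponent A v = toric_exponent A u"
    proof (rule ccontr)
      assume other: "\<not> ?thesis"
      have "0 = Poly_Mapping.lookup (toric_map A f) (toric_exponent A u)"
        using less.prems by (simp add: toric_ideal_iff)
      also have "\<dots> = (\<Sum>w\<in>Poly_Mapping.keys f. if w = u then c else 0)"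
        unfolding toric_map_eq_map_exponents lookup_map_exponents
        using other by (intro sum.cong) (auto simp: when_def c_def)
      also have "\<dots> = c" using u by simp
      finally show False using \<open>c \<noteq> 0\<close> by simp
    qed
    then obtain v where v: "v \<in> Poly_Mapping.keys f" "v \<noteq> u"
      and uv: "toric_exponent A u = toric_exponent A v" by (metis DiffE singletonI)
    define b where "b = mconst c * (monomial u - monomial v)"
    have "(monomial u - monomial v :: ('n, 'k) mpoly) \<in> toric_ideal A"
      by (rule binomial_in_toric_ideal[OF uv])
    then have b: "b \<in> toric_ideal A"
      by (simp add: b_def toric_ideal_iff toric_map_mult)
    have lookup_b: "Poly_Mapping.lookup b w = (c when w = u) - (c when w = v)" for w
      by (simp add: b_def right_diff_distrib mconst_monomial lookup_minus lookup_single when_def)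
    have "Poly_Mapping.keys (f - b) \<subseteq> Poly_Mapping.keys f - {u}"
      using u v by (auto simp: in_keys_iff lookup_minus lookup_b c_def when_def split: if_splits)
    then have "card (Poly_Mapping.keys (f - b)) < card (Poly_Mapping.keys f)"
      using u by (intro psubset_card_mono) auto
    moreover have "f - b \<in> toric_ideal A"
      using less.prems b toric_map_add[of A "f - b" b] by (simp add: toric_ideal_iff)
    ultimately have "P (f - b)" by (rule less.hyps)
    then have "P (b + (f - b))" unfolding b_def by (rule assms(3)[OF uv])
    then show ?thesis by simp
  qed
qed

section \<open>Logarithmic derivatives\<close>

text \<open>
  The derivation \<open>e\<^sub>j \<partial>/\<partial>e\<^sub>j\<close>, for which all monomials are eigenvectors.
\<close>

definition log_deriv :: "'v \<Rightarrow> ('v, 'k::comm_ring_1) mpoly \<Rightarrow> ('v, 'k) mpoly" where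
  "log_deriv j = Poly_Mapping.mapp (\<lambda>u c. of_nat (Poly_Mapping.lookup u j) * c)"

lemma lookup_log_deriv:
  "Poly_Mapping.lookup (log_deriv j f) u = of_nat (Poly_Mapping.lookup u j) * Poly_Mapping.lookup f u"
  by (simp add: log_deriv_def lookup_mapp when_def in_keys_iff)

lemma log_deriv_add: "log_deriv j (f + g) = log_deriv j f + log_deriv j g"
  by (rule poly_mapping_eqI) (simp add: lookup_log_deriv lookup_add distrib_left)

lemma log_deriv_0: "log_deriv j 0 = 0"
  by (rule poly_mapping_eqI) (simp add: lookup_log_deriv)

lemma log_deriv_single:
  "log_deriv j (Poly_Mapping.single u c) = Poly_Mapping.single u (of_nat (Poly_Mapping.lookup u j) * c)"
  by (rule poly_mapping_eqI) (simp add: lookup_log_deriv lookup_single when_def)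

lemma log_deriv_mconst: "log_deriv j (mconst c) = 0"
  by (simp add: mconst_def log_deriv_single)

lemma log_deriv_monomial: "log_deriv j (monomial u) = of_nat (Poly_Mapping.lookup u j) * monomial u"
  unfolding of_nat_eq_mconst mconst_monomial by (simp add: monomial_def log_deriv_single)

lemma log_deriv_mult: "log_deriv j (f * g) = f * log_deriv j g + g * log_deriv j f"
proof (induction f rule: mpoly_induct)
  case f: (single_add u c f)
  have "log_deriv j (Poly_Mapping.single u c * g) =
      Poly_Mapping.single u c * log_deriv j g + g * log_deriv j (Poly_Mapping.single u c)"
  proof (induction g rule: mpoly_induct)
    case g: (single_add v d g)
    have "log_deriv j (Poly_Mapping.single u c * Poly_Mapping.single v d) =
        Poly_Mapping.single u c * log_deriv j (Poly_Mapping.single v d) +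
        Poly_Mapping.single v d * log_deriv j (Poly_Mapping.single u c)"
      by (simp add: log_deriv_single mult_single lookup_add algebra_simps single_add)
    with g show ?case by (simp add: distrib_left distrib_right log_deriv_add algebra_simps)
  qed (simp add: log_deriv_0)
  with f show ?case by (simp add: log_deriv_add algebra_simps)
qed (simp add: log_deriv_0)

section \<open>Integral relations\<close>

lemma common_denominator:
  fixes q :: "'i \<Rightarrow> rat"
  assumes "finite J"
  shows "\<exists>N>0. \<exists>p :: 'i \<Rightarrow> int. \<forall>j\<in>J. of_int (p j) = of_nat N * q j"
  using assms
proof (induction J)
  case empty
  show ?case by auto
next
  case (insert i J)
  then obtain N p where N: "N > 0" "\<And>j. j \<in> J \<Longrightarrow> of_int (p j) = of_nat N * q j" by blast
  obtain a b where ab: "q i = Rat.Fract a b" "b > 0" by (cases "q i")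
  define p' where "p' j = (if j = i then int N * a else b * p j)" for j
  have "of_int (p' j) = of_nat (N * nat b) * q j" if "j \<in> insert i J" for j
    using that N(2) ab insert.hyps
    by (cases "j = i") (auto simp: p'_def Fract_of_int_quotient)
  moreover have "N * nat b > 0" using N(1) ab(2) by simp
  ultimately show ?case by blast
qed

definition integer_relation :: "nat ^ 'n ^ 'm \<Rightarrow> ('n::finite \<Rightarrow> int) \<Rightarrow> bool" where
  "integer_relation A d \<longleftrightarrow> (\<forall>i. (\<Sum>k\<in>UNIV. int (A $ i $ k) * d k) = 0)"

text \<open>
  The vectors \<open>p j\<close> are the columns of a rational projection onto the kernel of \<open>A\<close>, multiplied by
  a common denominator \<open>N\<close>.
\<close>

lemma integer_kernel_projection:
  fixes A :: "nat ^ 'n::finite ^ 'm::finite"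
  obtains N :: nat and p :: "'n \<Rightarrow> 'n \<Rightarrow> int" where "N > 0"
    and "\<And>j. integer_relation A (p j)"
    and "\<And>d k. integer_relation A d \<Longrightarrow> (\<Sum>j\<in>UNIV. d j * p j k) = int N * d k"
proof -
  define B :: "rat ^ 'n ^ 'm" where "B = (\<chi> i j. of_nat (A $ i $ j))"
  define V where "V = {v. B *v v = 0}"
  have "vec.subspace V"
    by (simp add: V_def vec.subspace_def matrix_vector_right_distrib vec.scale)
  then obtain g where g: "range g \<subseteq> V" "Vector_Spaces.linear (*s) (*s) g" "\<And>v. v \<in> V \<Longrightarrow> g v = v"
    using vec.linear_exists_left_inverse_on[OF vec.linear_id, of V] by auto
  obtain N and p' :: "'n \<times> 'n \<Rightarrow> int" where N: "N > 0"
    and p': "\<And>jk. of_int (p' jk) = of_nat N * (\<lambda>(j, k). g (axis j 1) $ k) jk"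
    using common_denominator[OF finite[of UNIV], of "\<lambda>(j, k). g (axis j 1) $ k"] by blast
  define p where "p j k = p' (j, k)" for j k
  have p: "of_int (p j k) = of_nat N * g (axis j 1) $ k" for j k
    using p'[of "(j, k)"] by (simp add: p_def)
  show thesis
  proof (rule that[OF N])
    fix j
    show "integer_relation A (p j)"
      unfolding integer_relation_def
    proof (rule allI)
      fix i
      have "B *v g (axis j 1) = 0" using g(1) by (auto simp: V_def)
      then have "(B *v g (axis j 1)) $ i = 0" by simp
      then have "of_int (\<Sum>k\<in>UNIV. int (A $ i $ k) * p j k) = (0 :: rat)"
        by (simp add: p matrix_vector_mult_def B_def mult.left_commute[of _ "of_nat N"]
            flip: sum_distrib_left)
      then show "(\<Sum>k\<in>UNIV. int (A $ i $ k) * p j k) = 0" by (simp only: of_int_eq_0_iff)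
    qed
  next
    fix d :: "'n \<Rightarrow> int" and k
    assume "integer_relation A d"
    then have d: "(\<Sum>k\<in>UNIV. int (A $ i $ k) * d k) = 0" for i
      unfolding integer_relation_def by blast
    define v :: "rat ^ 'n" where "v = (\<chi> j. of_int (d j))"
    have "(B *v v) $ i = of_int (\<Sum>k\<in>UNIV. int (A $ i $ k) * d k)" for i
      by (simp add: matrix_vector_mult_def B_def v_def)
    then have "v \<in> V" by (simp add: V_def vec_eq_iff d)
    then have "v = matrix g *v v" using g by (simp add: matrix_works)
    then have "v $ k = (\<Sum>j\<in>UNIV. g (axis j 1) $ k * v $ j)"
      by (metis (no_types, lifting) matrix_def matrix_vector_mult_def sum.cong vec_lambda_beta)
    then have "of_int (\<Sum>j\<in>UNIV. d j * p j k) = (of_int (int N * d k) :: rat)"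
      by (simp add: p v_def mult_ac flip: sum_distrib_left)
    then show "(\<Sum>j\<in>UNIV. d j * p j k) = int N * d k" by (simp only: of_int_eq_iff)
  qed
qed

section \<open>The Euler operator of a toric ideal\<close>

locale toric_powers =
  fixes A :: "nat ^ 'n::finite ^ 'm::finite"
    and I :: "('n, 'k::field_char_0) mpoly set"
  assumes I_eq: "I = toric_ideal A"

sublocale toric_powers \<subseteq> saturated_powers I "\<Prod>j\<in>UNIV. mvar j"
  by (rule saturated_powers.intro) (simp add: I_eq ideal_toric_ideal)

context toric_powers
begin

lemma prod_mem_satpow_2: "x \<in> I \<Longrightarrow> y \<in> I \<Longrightarrow> x * y \<in> satpow 2"
  using satpow_mult[OF I_subset_satpow I_subset_satpow, of x y] by (simp add: numeral_2_eq_2)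

text \<open>
  Every monomial divides a power of \<open>m\<close>, so all monomials behave like units.
\<close>

lemma satpow_cancel_monomial:
  assumes "monomial u * f \<in> satpow t"
  shows "f \<in> satpow t"
proof -
  define a where "a = (\<Sum>k\<in>UNIV. Poly_Mapping.lookup u k)"
  have le: "Poly_Mapping.lookup u k \<le> a" for k
    unfolding a_def by (rule member_le_sum) auto
  \<comment> \<open>the complementary factor of \<open>e\<^sup>u\<close> in \<open>m\<^sup>a\<close>\<close>
  define v where "v = Abs_poly_mapping (\<lambda>k. a - Poly_Mapping.lookup u k)"
  have "v + u = Abs_poly_mapping (\<lambda>_. a)"
    by (rule poly_mapping_eqI) (simp add: v_def lookup_add le)
  then have "monomial v * (monomial u * f) = f * (\<Prod>j\<in>UNIV. mvar j) ^ a"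
    by (simp add: prod_mvar_power monomial_add mult_ac flip: \<open>v + u = _\<close>)
  then show ?thesis
    using satpow_mult_left[OF assms, of "monomial v"] satpow_cancel[of f a t] by simp
qed

definition expdiff :: "('n \<Rightarrow>\<^sub>0 nat) \<Rightarrow> ('n \<Rightarrow>\<^sub>0 nat) \<Rightarrow> 'n \<Rightarrow> int" where
  "expdiff x y k = int (Poly_Mapping.lookup x k) - int (Poly_Mapping.lookup y k)"

text \<open>
  In Laurent polynomials this is the congruence \<open>M (e\<^sup>d - 1) \<equiv> r\<close> modulo the square of the ideal. As
  \<open>d\<close> may have negative entries, it is written as \<open>d = x - y\<close> and the congruence is multiplied by
  \<open>e\<^sup>y\<close>. By \<open>log_classD\<close> the choice of \<open>x\<close> and \<open>y\<close> does not matter. Since \<open>e\<^sup>d - 1\<close> is the first-order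
  part of the logarithm of \<open>e\<^sup>d\<close>, the relation is additive in \<open>(d, r)\<close> on integer relations \<open>d\<close>.
\<close>

definition log_class :: "('n, 'k) mpoly \<Rightarrow> ('n \<Rightarrow> int) \<Rightarrow> ('n, 'k) mpoly \<Rightarrow> bool" where
  "log_class M d r \<longleftrightarrow>
     (\<exists>x y. expdiff x y = d \<and> M * (monomial x - monomial y) - monomial y * r \<in> satpow 2)"

lemma log_classI:
  assumes "expdiff x y = d" "M * (monomial x - monomial y) - monomial y * r \<in> satpow 2"
  shows "log_class M d r"
  using assms unfolding log_class_def by blast

lemma ex_expdiff: "\<exists>x y. expdiff x y = d"
  by (rule exI[of _ "Abs_poly_mapping (\<lambda>k. nat (d k))"],
      rule exI[of _ "Abs_poly_mapping (\<lambda>k. nat (- d k))"]) (auto simp: expdiff_def)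

lemma integer_relation_expdiff:
  "integer_relation A (expdiff x y) \<longleftrightarrow> toric_exponent A x = toric_exponent A y"
proof -
  have "toric_exponent A x = toric_exponent A y \<longleftrightarrow>
      (\<forall>i. int (Poly_Mapping.lookup (toric_exponent A x) i) =
           int (Poly_Mapping.lookup (toric_exponent A y) i))"
    by (simp add: poly_mapping_eq_iff fun_eq_iff)
  then show ?thesis
    by (simp add: integer_relation_def expdiff_def toric_exponent_def right_diff_distrib
        sum_subtractf)
qed

lemma integer_relation_scale: "integer_relation A d \<Longrightarrow> integer_relation A (\<lambda>k. n * d k)"
  by (simp add: integer_relation_def mult.left_commute[of _ n] flip: sum_distrib_left)

lemma integer_relation_sum:
  "(\<And>j. j \<in> J \<Longrightarrow> integer_relation A (d j)) \<Longrightarrow> integer_relation A (\<lambda>k. \<Sum>j\<in>J. d j k)"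
  unfolding integer_relation_def sum_distrib_left
  by (subst sum.swap) simp

lemma binomial_in: "integer_relation A (expdiff x y) \<Longrightarrow> monomial x - monomial y \<in> I"
  unfolding I_eq integer_relation_expdiff by (rule binomial_in_toric_ideal)

text \<open>
  If \<open>x' - y' = x - y\<close>, then \<open>e\<^sup>y\<close> times the congruence for \<open>(x', y')\<close> is \<open>e\<^sup>y\<^sup>'\<close> times the one for \<open>(x, y)\<close>,
  and monomials can be cancelled.
\<close>

lemma log_classD:
  assumes "log_class M (expdiff x y) r"
  shows "M * (monomial x - monomial y) - monomial y * r \<in> satpow 2"
proof -
  obtain x' y' where d: "expdiff x' y' = expdiff x y"
    and mem: "M * (monomial x' - monomial y') - monomial y' * r \<in> satpow 2"
    using assms by (auto simp: log_class_def)
  have "x + y' = x' + y"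
  proof (rule poly_mapping_eqI)
    fix k
    show "Poly_Mapping.lookup (x + y') k = Poly_Mapping.lookup (x' + y) k"
      using fun_cong[OF d, of k] unfolding lookup_add expdiff_def by linarith
  qed
  then have "monomial x * monomial y' = (monomial x' * monomial y :: ('n, 'k) mpoly)"
    by (simp flip: monomial_add)
  moreover have "monomial y * (M * (monomial x' - monomial y') - monomial y' * r) =
      M * (monomial x' * monomial y) - monomial y * monomial y' * (M + r)"
    "monomial y' * (M * (monomial x - monomial y) - monomial y * r) =
      M * (monomial x * monomial y') - monomial y * monomial y' * (M + r)"
    by (simp_all add: algebra_simps)
  ultimately have "monomial y * (M * (monomial x' - monomial y') - monomial y' * r) =
      monomial y' * (M * (monomial x - monomial y) - monomial y * r)"
    by simp
  then show ?thesis
    using satpow_mult_left[OF mem, of "monomial y"] by (auto intro: satpow_cancel_monomial)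
qed

text \<open>
  The defect of additivity is the product of two binomials in the ideal.
\<close>

lemma log_class_add:
  assumes "log_class M d r" "log_class M d' r'" "integer_relation A d" "integer_relation A d'"
  shows "log_class M (\<lambda>k. d k + d' k) (r + r')"
proof -
  \<comment> \<open>choose Laurent representatives and multiply them: \<open>d + d' = (x + x') - (y + y')\<close>\<close>
  obtain x y x' y' where xy: "expdiff x y = d" "expdiff x' y' = d'" using ex_expdiff by metis
  let ?B = "\<lambda>x y. monomial x - monomial y :: ('n, 'k) mpoly"
  have "?B x y * ?B x' y' \<in> satpow 2"
    using assms(3,4) xy by (intro prod_mem_satpow_2 binomial_in) simp_all
  then have "M * (?B x y * ?B x' y') \<in> satpow 2" by (rule satpow_mult_left)
  moreover have "monomial y' * (M * ?B x y - monomial y * r) \<in> satpow 2"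
    using assms(1) xy by (intro satpow_mult_left log_classD) simp
  moreover have "monomial y * (M * ?B x' y' - monomial y' * r') \<in> satpow 2"
    using assms(2) xy by (intro satpow_mult_left log_classD) simp
  ultimately have "M * (?B x y * ?B x' y') + monomial y' * (M * ?B x y - monomial y * r)
      + monomial y * (M * ?B x' y' - monomial y' * r') \<in> satpow 2"
    by (intro satpow_add)
  also have "M * (?B x y * ?B x' y') + monomial y' * (M * ?B x y - monomial y * r)
      + monomial y * (M * ?B x' y' - monomial y' * r') =
      M * ?B (x + x') (y + y') - monomial (y + y') * (r + r')"
    by (simp add: monomial_add algebra_simps)
  finally show ?thesis
    using xy by (intro log_classI) (auto simp: expdiff_def lookup_add)
qed

lemma log_class_0: "log_class M (\<lambda>k. 0) 0"
  by (rule log_classI[of 0 0]) (simp_all add: expdiff_def fun_eq_iff satpow_zero)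

lemma log_class_minus:
  assumes "log_class M d r" "integer_relation A d" "r \<in> I"
  shows "log_class M (\<lambda>k. - d k) (- r)"
proof -
  obtain x y where xy: "expdiff x y = d" using ex_expdiff by metis
  have "(monomial x - monomial y) * r \<in> satpow 2"
    using assms xy by (intro prod_mem_satpow_2 binomial_in) simp_all
  moreover have "M * (monomial x - monomial y) - monomial y * r \<in> satpow 2"
    using assms(1) xy by (intro log_classD) simp
  ultimately have
    "(monomial x - monomial y) * r - (M * (monomial x - monomial y) - monomial y * r) \<in> satpow 2"
    by (rule satpow_diff)
  also have "(monomial x - monomial y) * r - (M * (monomial x - monomial y) - monomial y * r) =
      M * (monomial y - monomial x) - monomial x * (- r)"
    by (simp add: algebra_simps)
  finally show ?thesis
    using xy by (intro log_classI) (auto simp: expdiff_def)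
qed

lemma log_class_scale:
  assumes "log_class M d r" "integer_relation A d" "r \<in> I"
  shows "log_class M (\<lambda>k. n * d k) (of_int n * r)"
proof -
  have nat: "log_class M (\<lambda>k. int a * d k) (of_nat a * r)" for a
  proof (induction a)
    case 0
    show ?case by (simp add: log_class_0)
  next
    case (Suc a)
    from log_class_add[OF Suc assms(1) integer_relation_scale[OF assms(2)] assms(2)]
    show ?case by (simp add: algebra_simps)
  qed
  show ?thesis
  proof (cases n)
    case (nonneg a)
    then show ?thesis using nat[of a] by simp
  next
    case (neg a)
    have "of_nat (Suc a) * r \<in> I"
      using pow_mult_left[of r 1] assms(3) unfolding pow_1 by blast
    from log_class_minus[OF nat integer_relation_scale[OF assms(2)] this]
    show ?thesis unfolding neg by (simp only: of_int_minus of_int_of_nat_eq mult_minus_left)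
  qed
qed

lemma log_class_sum:
  assumes "\<And>j. j \<in> J \<Longrightarrow> log_class M (d j) (r j)" "\<And>j. j \<in> J \<Longrightarrow> integer_relation A (d j)"
  shows "log_class M (\<lambda>k. \<Sum>j\<in>J. d j k) (\<Sum>j\<in>J. r j)"
  using assms
proof (induction J rule: infinite_finite_induct)
  case (insert j J)
  have "log_class M (\<lambda>k. d j k + (\<Sum>j\<in>J. d j k)) (r j + (\<Sum>j\<in>J. r j))"
    using insert.prems by (intro log_class_add insert.IH integer_relation_sum) auto
  then show ?case using insert.hyps by simp
qed (simp_all add: log_class_0)

text \<open>
  From a congruence for \<open>e\<^sup>N\<^sup>d - 1\<close> to one for \<open>e\<^sup>d - 1\<close>: the former is \<open>N (e\<^sup>d - 1)\<close> to first order.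
\<close>

lemma log_class_divide:
  assumes "log_class M (\<lambda>k. int N * expdiff x y k) r" "integer_relation A (expdiff x y)" "N > 0"
  shows "of_nat N * M * (monomial x - monomial y) - monomial y * r \<in> satpow 2"
proof -
  obtain n where n: "N = Suc n" using assms(3) by (cases N) auto
  let ?X = "monomial x :: ('n, 'k) mpoly" and ?Y = "monomial y :: ('n, 'k) mpoly"
  have XY: "?X - ?Y \<in> I" by (rule binomial_in[OF assms(2)])
  \<comment> \<open>first-order expansion of \<open>X\<^sup>a\<^sup>+\<^sup>1\<close> at \<open>Y\<close>; the induction multiplies it by \<open>X = (X - Y) + Y\<close>\<close>
  have taylor: "?X ^ Suc a - ?Y ^ Suc a - of_nat (Suc a) * ?Y ^ a * (?X - ?Y) \<in> satpow 2" for a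
  proof (induction a)
    case 0
    show ?case by (simp add: satpow_zero)
  next
    case (Suc a)
    have "?X ^ Suc a - ?Y ^ Suc a \<in> I"
      unfolding power_diff_sumr2 mult.commute[of "?X - ?Y"]
      using pow_mult_left[of "?X - ?Y" 1] XY unfolding pow_1 by blast
    then have "(?X - ?Y) * (?X ^ Suc a - ?Y ^ Suc a) \<in> satpow 2"
      by (rule prod_mem_satpow_2[OF XY])
    moreover have "?Y * (?X ^ Suc a - ?Y ^ Suc a - of_nat (Suc a) * ?Y ^ a * (?X - ?Y)) \<in> satpow 2"
      by (rule satpow_mult_left[OF Suc])
    ultimately have "(?X - ?Y) * (?X ^ Suc a - ?Y ^ Suc a) +
        ?Y * (?X ^ Suc a - ?Y ^ Suc a - of_nat (Suc a) * ?Y ^ a * (?X - ?Y)) \<in> satpow 2"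
      by (rule satpow_add)
    also have "(?X - ?Y) * (?X ^ Suc a - ?Y ^ Suc a) +
        ?Y * (?X ^ Suc a - ?Y ^ Suc a - of_nat (Suc a) * ?Y ^ a * (?X - ?Y)) =
        ?X ^ Suc (Suc a) - ?Y ^ Suc (Suc a) - of_nat (Suc (Suc a)) * ?Y ^ Suc a * (?X - ?Y)"
      by (simp add: algebra_simps)
    finally show ?case .
  qed
  define x' y' where "x' = Abs_poly_mapping (\<lambda>k. N * Poly_Mapping.lookup x k)"
    and "y' = Abs_poly_mapping (\<lambda>k. N * Poly_Mapping.lookup y k)"
  have pow: "monomial x' = ?X ^ N" "monomial y' = ?Y ^ N"
    unfolding x'_def y'_def monomial_power[symmetric] by (simp_all add: Abs_finite_lookup)
  have "(\<lambda>k. int N * expdiff x y k) = expdiff x' y'"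
    by (auto simp: expdiff_def x'_def y'_def algebra_simps)
  then have "M * (?X ^ N - ?Y ^ N) - ?Y ^ N * r \<in> satpow 2"
    using log_classD[of M x' y' r] assms(1) by (simp add: pow)
  from satpow_diff[OF this satpow_mult_left[OF taylor[of n], of M]]
  have "?Y ^ n * (of_nat N * M * (?X - ?Y) - ?Y * r) \<in> satpow 2"
    unfolding n by (simp add: algebra_simps)
  moreover have "?Y ^ n = monomial (Abs_poly_mapping (\<lambda>k. n * Poly_Mapping.lookup y k))"
    unfolding monomial_power[symmetric] by (simp add: Abs_finite_lookup)
  ultimately show ?thesis by (auto intro: satpow_cancel_monomial)
qed

text \<open>
  Nonzero integers are units because the coefficients form a field of characteristic zero.
\<close>

lemma cancel_unit_monomial:
  assumes "n > 0" "of_nat n * (monomial u * x) \<in> satpow s"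
  shows "x \<in> satpow s"
proof -
  have "mconst (inverse (of_nat n)) * (of_nat n :: ('n, 'k) mpoly) = 1"
    using assms(1) by (simp add: of_nat_eq_mconst mconst_mult[symmetric]) (simp add: mconst_def)
  then have "mconst (inverse (of_nat n)) * (of_nat n * (monomial u * x)) = monomial u * x"
    by (simp add: mult.assoc[symmetric])
  then show ?thesis
    using satpow_mult_left[OF assms(2), of "mconst (inverse (of_nat n))"]
    by (auto intro: satpow_cancel_monomial)
qed

text \<open>
  The weights are \<open>e\<^sup>y (e\<^sup>p\<^sup>j - 1)\<close>, where the entries of \<open>y\<close> are large enough to make all exponents
  nonnegative. Additivity and \<open>\<Sum>\<^sub>j d\<^sub>j p\<^sub>j = N d\<close> give the congruence.
\<close>

lemma ex_weights:
  obtains N :: nat and y :: "'n \<Rightarrow>\<^sub>0 nat" and W :: "'n \<Rightarrow> ('n, 'k) mpoly" where "N > 0"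
    and "\<And>j. W j \<in> I"
    and "\<And>d. integer_relation A d \<Longrightarrow>
           log_class (monomial y) (\<lambda>k. int N * d k) (\<Sum>j\<in>UNIV. of_int (d j) * W j)"
proof -
  obtain N :: nat and p :: "'n \<Rightarrow> 'n \<Rightarrow> int" where N: "N > 0"
    and p: "\<And>j. integer_relation A (p j)"
    and proj: "\<And>d k. integer_relation A d \<Longrightarrow> (\<Sum>j\<in>UNIV. d j * p j k) = int N * d k"
    by (rule integer_kernel_projection[of A]) (rule that)
  define b where "b = (\<Sum>j\<in>UNIV. \<Sum>k\<in>UNIV. \<bar>p j k\<bar>)"
  have b: "\<bar>p j k\<bar> \<le> b" for j k
  proof -
    have "\<bar>p j k\<bar> \<le> (\<Sum>k\<in>UNIV. \<bar>p j k\<bar>)" by (rule member_le_sum) auto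
    also have "\<dots> \<le> b" unfolding b_def by (rule member_le_sum) (auto intro: sum_nonneg)
    finally show ?thesis .
  qed
  define y where "y = Abs_poly_mapping (\<lambda>k::'n. nat b)"
  define x where "x j = Abs_poly_mapping (\<lambda>k. nat (b + p j k))" for j
  define W where "W j = (monomial (x j) - monomial y :: ('n, 'k) mpoly)" for j
  have diff: "expdiff (x j) y = p j" for j
  proof
    fix k
    have "0 \<le> b" "0 \<le> b + p j k" using b[of j k] by linarith+
    then show "expdiff (x j) y k = p j k" by (simp add: expdiff_def x_def y_def)
  qed
  have W: "W j \<in> I" for j
    unfolding W_def by (rule binomial_in) (simp add: diff p)
  have class_p: "log_class (monomial y) (p j) (W j)" for j
    by (rule log_classI[OF diff]) (simp add: W_def mult.commute satpow_zero)
  show thesis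
  proof (rule that[OF N W])
    fix d assume d: "integer_relation A d"
    have "log_class (monomial y) (\<lambda>k. \<Sum>j\<in>UNIV. d j * p j k) (\<Sum>j\<in>UNIV. of_int (d j) * W j)"
      by (rule log_class_sum[OF log_class_scale[OF class_p p W] integer_relation_scale[OF p]])
    then show "log_class (monomial y) (\<lambda>k. int N * d k) (\<Sum>j\<in>UNIV. of_int (d j) * W j)"
      by (simp add: proj[OF d])
  qed
qed

text \<open>
  On a binomial \<open>e\<^sup>u - e\<^sup>v\<close> of the ideal, \<open>W\<^sub>j D\<^sub>j\<close> has the value
  \<open>u\<^sub>j W\<^sub>j (e\<^sup>u - e\<^sup>v) + (u\<^sub>j - v\<^sub>j) W\<^sub>j e\<^sup>v\<close>. The first summand is in the square of the ideal, and the sum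
  of the second ones is \<open>e\<^sup>v \<Sum>\<^sub>j d\<^sub>j W\<^sub>j\<close> for \<open>d = u - v\<close>, which is congruent to
  \<open>N M (e\<^sup>u - e\<^sup>v)\<close> by the choice of the weights.
\<close>

lemma euler_mod_satpow_2:
  assumes N: "N > 0" and W: "\<And>j. W j \<in> I"
    and log: "\<And>d. integer_relation A d \<Longrightarrow>
           log_class M (\<lambda>k. int N * d k) (\<Sum>j\<in>UNIV. of_int (d j) * W j)"
    and "f \<in> I"
  shows "(\<Sum>j\<in>UNIV. W j * log_deriv j f) - of_nat N * M * f \<in> satpow 2"
proof -
  have "f \<in> toric_ideal A" using assms(4) by (simp add: I_eq)
  then show ?thesis
  proof (induction rule: toric_ideal_induct)
    case zero
    show ?case by (simp add: log_deriv_0 satpow_zero)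
  next
    case (binomial u v a f)
    have uv: "integer_relation A (expdiff u v)"
      using binomial(1) by (simp add: integer_relation_expdiff)
    let ?B = "monomial u - monomial v :: ('n, 'k) mpoly"
    let ?r = "\<Sum>j\<in>UNIV. of_int (expdiff u v j) * W j"
    let ?s = "\<Sum>j\<in>UNIV. of_nat (Poly_Mapping.lookup u j) * W j"
    let ?E = "\<lambda>f. (\<Sum>j\<in>UNIV. W j * log_deriv j f) - of_nat N * M * f"
    have "?s * ?B \<in> satpow 2"
      unfolding sum_distrib_right mult.assoc
      by (rule satpow_sum[OF satpow_mult_left[OF prod_mem_satpow_2[OF W binomial_in[OF uv]]]])
    then have "?s * ?B - (of_nat N * M * ?B - monomial v * ?r) \<in> satpow 2"
      by (rule satpow_diff[OF _ log_class_divide[OF log[OF uv] uv N]])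
    also have "?s * ?B - (of_nat N * M * ?B - monomial v * ?r) = ?E ?B"
    proof -
      have "log_deriv j ?B =
          of_nat (Poly_Mapping.lookup u j) * ?B + of_int (expdiff u v j) * monomial v" for j
        using log_deriv_add[of j ?B "monomial v"]
        by (simp add: log_deriv_monomial expdiff_def algebra_simps)
      then have "W j * log_deriv j ?B =
          of_nat (Poly_Mapping.lookup u j) * W j * ?B + of_int (expdiff u v j) * W j * monomial v" for j
        by (simp only: distrib_left mult_ac)
      then have "(\<Sum>j\<in>UNIV. W j * log_deriv j ?B) = ?s * ?B + ?r * monomial v"
        by (simp only: sum.distrib sum_distrib_right)
      then show ?thesis by (simp add: mult.commute)
    qed
    finally have "mconst a * ?E ?B \<in> satpow 2" by (rule satpow_mult_left)
    then have "mconst a * ?E ?B + ?E f \<in> satpow 2" by (rule satpow_add[OF _ binomial(2)])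
    also have "mconst a * ?E ?B + ?E f = ?E (mconst a * ?B + f)"
    proof -
      have "W j * log_deriv j (mconst a * ?B + f) =
          mconst a * (W j * log_deriv j ?B) + W j * log_deriv j f" for j
        by (simp add: log_deriv_add log_deriv_mult log_deriv_mconst distrib_left mult.left_commute)
      then have "(\<Sum>j\<in>UNIV. W j * log_deriv j (mconst a * ?B + f)) =
          mconst a * (\<Sum>j\<in>UNIV. W j * log_deriv j ?B) + (\<Sum>j\<in>UNIV. W j * log_deriv j f)"
        by (simp only: sum.distrib sum_distrib_left)
      then show ?thesis by (simp add: distrib_left right_diff_distrib mult.left_commute)
    qed
    finally show ?case .
  qed
qed

lemma saturation_eq_symbolic_power_toric:
  "saturation ring_of_type_algebra (ideal_power ring_of_type_algebra I t) (\<Prod>j\<in>UNIV. mvar j) =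
     symbolic_power ring_of_type_algebra I t"
proof -
  obtain N :: nat and y and W :: "'n \<Rightarrow> ('n, 'k) mpoly" where N: "N > 0" and W: "\<And>j. W j \<in> I"
    and log: "\<And>d. integer_relation A d \<Longrightarrow>
           log_class (monomial y) (\<lambda>k. int N * d k) (\<Sum>j\<in>UNIV. of_int (d j) * W j)"
    by (rule ex_weights) blast
  have m: "(\<Prod>j\<in>UNIV. mvar j) = (monomial (Abs_poly_mapping (\<lambda>_. 1)) :: ('n, 'k) mpoly)"
    using prod_mvar_power[of 1] by simp
  have "adapted_euler_operator I (\<Prod>j\<in>UNIV. mvar j) UNIV log_deriv W (of_nat N * monomial y)"
  proof (rule adapted_euler_operator.intro[OF saturated_powers_axioms],
         rule adapted_euler_operator_axioms.intro)
    show "f \<in> I \<or> g \<in> I" if "f * g \<in> I" for f g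
      using toric_ideal_prime[of f g A] that by (simp add: I_eq)
    show "(\<Prod>j\<in>UNIV. mvar j) \<notin> I"
      unfolding m I_eq by (rule monomial_notin_toric_ideal)
    show "\<exists>d. log_deriv j (\<Prod>j\<in>UNIV. mvar j) = d * (\<Prod>j\<in>UNIV. mvar j :: ('n, 'k) mpoly)" for j
      unfolding m log_deriv_monomial by blast
    show "f \<in> satpow s" if "of_nat (Suc t) * (of_nat N * monomial y * f) \<in> satpow s" for t s f
      using cancel_unit_monomial[of "Suc t * N" y f s] that N
      by (simp only: of_nat_mult mult.assoc) simp
  qed (rule log_deriv_add log_deriv_mult W euler_mod_satpow_2[OF N W log], assumption?)+
  then show ?thesis by (rule adapted_euler_operator.saturation_eq_symbolic_power)
qed

end

section \<open>Symbolic powers of toric ideals\<close>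

theorem theorem3p8:
  fixes A :: "nat ^ 'n::finite ^ 'm::finite"
    and I :: "('n, 'k::{alg_closed_field, field_char_0}) mpoly set"
    and t :: nat
  assumes "\<And>j. column j A \<noteq> 0"
    and "I = toric_ideal A"
    and "t \<ge> 1"
  shows "saturation mpoly_ring (ideal_power mpoly_ring I t) (\<Prod>j\<in>UNIV. mvar j) =
         symbolic_power mpoly_ring I t"
proof -
  interpret toric_powers A I
    by (rule toric_powers.intro) (rule assms(2))
  show ?thesis by (rule saturation_eq_symbolic_power_toric)
qed

end
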